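(* Let $d\ge2$. The star duality $\Phi:\mathcal{S}_{rc}^d\to\mathcal{S}_{rc}^d$ is continuous with respect to the radial Attouch-Wets distance $d_{AW^r}$ (on both domain and codomain).
   Context: $\mathbb{N}=\{1,2,\dots\}$; $B_2^d$ and $\mathbb{S}^{d-1}$ are the closed Euclidean unit ball and the unit sphere of $\mathbb{R}^d$. A star set is a non-empty $A\subseteq\mathbb{R}^d$ with $ta\in A$ for all $a\in A$, $0\le t\le 1$. Its radial function is $\rho_A:\mathbb{S}^{d-1}\to[0,\infty]$, $\rho_A(\theta)=\sup\{\lambda\ge 0:\lambda\theta\in A\}$. A star body is a star set $A$ that is radially closed: $\rho_A(\theta)\theta\in A$ whenever $\rho_A(\theta)<\infty$ (it may be unbounded or non-closed; it is determined by $\rho_A$). $\mathcal{S}_{rc}^d$ is the family of all star bodies in $\mathbb{R}^d$. The star duality $\Phi$ sends $A\in\mathcal{S}_{rc}^d$ to the star body $\Phi(A)$ with radial function $\rho_{\Phi(A)}=1/\rho_A$, with the conventions $1/0=\infty$, $1/\infty=0$. The radial sum $A_1\tilde{+}A_2$ is the star body with radial function $\rho_{A_1}+\rho_{A_2}$. The radial distance from $x\in\mathbb{R}^d$ to $A\in\mathcal{S}_{rc}^d$ is $d_r(x,A)=\inf\{\alpha>0: x\in A\tilde{+}\alpha B_2^d\}\in[0,\infty)$. The radial Attouch-Wets distance is the metric on $\mathcal{S}_{rc}^d$ given by $d_{AW^r}(A_1,A_2)=\sup_{j\in\mathbb{N}}\min\{\frac1j,\sup_{\|x\|\le j}|d_r(x,A_1)-d_r(x,A_2)|\}$.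 *)

theory Defs
  imports "HOL-Analysis.Analysis"
begin

definition star_set :: "'a::euclidean_space set \<Rightarrow> bool" where
  "star_set A \<longleftrightarrow> A \<noteq> {} \<and> (\<forall>a\<in>A. \<forall>t. 0 \<le> t \<and> t \<le> 1 \<longrightarrow> t *\<^sub>R a \<in> A)"

text \<open>The radial function is only meaningful for directions on the unit sphere; every use
  below restricts it to \<^term>\<open>sphere 0 1\<close>.\<close>

definition radial_function :: "'a::euclidean_space set \<Rightarrow> 'a \<Rightarrow> ennreal" where
  "radial_function A \<theta> = (SUP l\<in>{l. 0 \<le> l \<and> l *\<^sub>R \<theta> \<in> A}. ennreal l)"

definition star_body :: "'a::euclidean_space set \<Rightarrow> bool" where
  "star_body A \<longleftrightarrow> star_set A \<and>
     (\<forall>\<theta>\<in>sphere 0 1. radial_function A \<theta> < \<infinity> \<longrightarrow> enn2real (radial_function A \<theta>) *\<^sub>R \<theta> \<in> A)"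

definition star_bodies :: "'a::euclidean_space set set" where
  "star_bodies = {A. star_body A}"

definition has_radial_function :: "'a::euclidean_space set \<Rightarrow> ('a \<Rightarrow> ennreal) \<Rightarrow> bool" where
  "has_radial_function A f \<longleftrightarrow> star_body A \<and> (\<forall>\<theta>\<in>sphere 0 1. radial_function A \<theta> = f \<theta>)"

text \<open>Existence and uniqueness hold for every \<open>f\<close>: see \<open>ex1_has_radial_function\<close> below.\<close>

definition star_body_of :: "('a::euclidean_space \<Rightarrow> ennreal) \<Rightarrow> 'a set" where
  "star_body_of f = (THE A. has_radial_function A f)"

text \<open>On \<^typ>\<open>ennreal\<close>, \<open>inverse 0 = \<infinity>\<close> and \<open>inverse \<infinity> = 0\<close>.\<close>

definition star_duality :: "'a::euclidean_space set \<Rightarrow> 'a set" where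
  "star_duality A = star_body_of (\<lambda>\<theta>. inverse (radial_function A \<theta>))"

definition radial_sum :: "'a::euclidean_space set \<Rightarrow> 'a set \<Rightarrow> 'a set" where
  "radial_sum A B = star_body_of (\<lambda>\<theta>. radial_function A \<theta> + radial_function B \<theta>)"

definition radial_dist :: "'a::euclidean_space \<Rightarrow> 'a set \<Rightarrow> real" where
  "radial_dist x A = Inf {\<alpha>. \<alpha> > 0 \<and> x \<in> radial_sum A ((*\<^sub>R) \<alpha> ` cball 0 1)}"

text \<open>Both suprema are taken over bounded sets of reals when \<open>A\<close> and \<open>B\<close> are star bodies,
  since then \<open>0 \<le> radial_dist x A \<le> norm x\<close> (lemmas \<open>radial_dist_nonneg\<close> and
  \<open>radial_dist_le_norm\<close>).\<close>

definition radial_AW_dist :: "'a::euclidean_space set \<Rightarrow> 'a set \<Rightarrow> real" where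
  "radial_AW_dist A B =
     (SUP j\<in>{1::nat..}. min (1 / real j)
        (SUP x\<in>cball 0 (real j). \<bar>radial_dist x A - radial_dist x B\<bar>))"


lemma mem_star_body_iff:
  assumes "star_body A" "\<theta> \<in> sphere 0 1" "0 \<le> r"
  shows "r *\<^sub>R \<theta> \<in> A \<longleftrightarrow> ennreal r \<le> radial_function A \<theta>"
proof
  assume "r *\<^sub>R \<theta> \<in> A"
  then show "ennreal r \<le> radial_function A \<theta>"
    unfolding radial_function_def using assms(3) by (intro SUP_upper) auto
next
  assume le: "ennreal r \<le> radial_function A \<theta>"
  have star: "t *\<^sub>R a \<in> A" if "a \<in> A" "0 \<le> t" "t \<le> 1" for a t
    using assms(1) that by (auto simp: star_body_def star_set_def)
  have down: "r *\<^sub>R \<theta> \<in> A" if "l *\<^sub>R \<theta> \<in> A" "r \<le> l" for l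
  proof (cases "l = 0")
    case True then show ?thesis using that assms(3) by simp
  next
    case False
    then show ?thesis using star[OF that(1), of "r / l"] that assms(3) by auto
  qed
  show "r *\<^sub>R \<theta> \<in> A"
  proof (cases "ennreal r = radial_function A \<theta>")
    case True
    then have "radial_function A \<theta> < \<infinity>" by (metis ennreal_less_top infinity_ennreal_def)
    then have "enn2real (radial_function A \<theta>) *\<^sub>R \<theta> \<in> A"
      using assms(1,2) by (auto simp: star_body_def)
    then show ?thesis using True assms(3) by (metis enn2real_ennreal)
  next
    case False
    then have "ennreal r < radial_function A \<theta>" using le by simp
    then obtain l where "0 \<le> l" "l *\<^sub>R \<theta> \<in> A" "ennreal r < ennreal l"
      unfolding radial_function_def less_SUP_iff by auto
    then show ?thesis using down[of l] assms(3) by (simp add: ennreal_less_iff)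
  qed
qed

lemma zero_in_star_body: "star_body A \<Longrightarrow> 0 \<in> A"
  unfolding star_body_def star_set_def by force

lemma polar_form:
  fixes x :: "'a::euclidean_space"
  obtains \<theta> where "\<theta> \<in> sphere 0 1" "x = norm x *\<^sub>R \<theta>"
proof (cases "x = 0")
  case True
  have "(SOME i. i \<in> (Basis::'a set)) \<in> sphere 0 1" by (simp add: SOME_Basis)
  then show ?thesis using that[of "SOME i. i \<in> Basis"] True by simp
next
  case False
  then show ?thesis using that[of "sgn x"] by (simp add: sgn_div_norm)
qed

lemma star_body_eqI:
  assumes "star_body A" "star_body B"
    and "\<And>\<theta>. \<theta> \<in> sphere 0 1 \<Longrightarrow> radial_function A \<theta> = radial_function B \<theta>"
  shows "A = B"
proof (rule set_eqI)
  fix x :: 'a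
  obtain \<theta> where "\<theta> \<in> sphere 0 1" "x = norm x *\<^sub>R \<theta>" by (rule polar_form)
  then show "x \<in> A \<longleftrightarrow> x \<in> B"
    using mem_star_body_iff[of A \<theta> "norm x"] mem_star_body_iff[of B \<theta> "norm x"] assms by simp
qed

lemma ex_has_radial_function: "\<exists>A. has_radial_function A f"
proof -
  define A where "A = {r *\<^sub>R \<theta> | r \<theta>. 0 \<le> r \<and> \<theta> \<in> sphere 0 1 \<and> ennreal r \<le> f \<theta>}"
  have mem: "r *\<^sub>R \<theta> \<in> A \<longleftrightarrow> ennreal r \<le> f \<theta>" if th: "\<theta> \<in> sphere 0 1" and r: "0 \<le> r" for r \<theta>
  proof
    assume "r *\<^sub>R \<theta> \<in> A"
    then obtain s \<eta> where s: "0 \<le> s" "\<eta> \<in> sphere 0 1" "ennreal s \<le> f \<eta>" "r *\<^sub>R \<theta> = s *\<^sub>R \<eta>"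
      unfolding A_def by auto
    have "norm (r *\<^sub>R \<theta>) = norm (s *\<^sub>R \<eta>)" using s(4) by (rule arg_cong)
    then have "r = s" using s(1,2) th r by (simp add: abs_of_nonneg)
    then show "ennreal r \<le> f \<theta>" using s by (cases "r = 0") auto
  qed (use that in \<open>auto simp: A_def\<close>)
  have ne: "A \<noteq> {}"
  proof -
    obtain \<theta> :: 'a where "\<theta> \<in> sphere 0 1" by (rule polar_form)
    then have "0 *\<^sub>R \<theta> \<in> A" using mem[of \<theta> 0] by simp
    then show ?thesis by blast
  qed
  have star: "star_set A"
    unfolding star_set_def
  proof (intro conjI ballI allI impI ne)
    fix a t assume a: "a \<in> A" and t: "0 \<le> t \<and> t \<le> (1::real)"
    then obtain r \<theta> where r: "a = r *\<^sub>R \<theta>" "0 \<le> r" "\<theta> \<in> sphere 0 1" "ennreal r \<le> f \<theta>"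
      unfolding A_def by auto
    have "ennreal (t * r) \<le> ennreal r"
      using t r by (intro ennreal_leI) (simp add: mult_left_le_one_le)
    then have "ennreal (t * r) \<le> f \<theta>" using r(4) by order
    then show "t *\<^sub>R a \<in> A" using mem[of \<theta> "t * r"] r t by simp
  qed
  have rf: "radial_function A \<theta> = f \<theta>" if th: "\<theta> \<in> sphere 0 1" for \<theta>
  proof -
    have "radial_function A \<theta> = (SUP l\<in>{l. 0 \<le> l \<and> ennreal l \<le> f \<theta>}. ennreal l)"
      unfolding radial_function_def using mem[OF th] by (intro SUP_cong) auto
    also have "\<dots> = f \<theta>"
    proof (cases "f \<theta>")
      case (real r)
      then show ?thesis by (intro antisym SUP_least SUP_upper2[of r]) auto
    next
      case top
      then show ?thesis by (auto simp: SUP_eq_top_iff ennreal_less_iff)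
        (metis ennreal_less_iff enn2real_nonneg ennreal_enn2real gt_ex order_less_imp_le order_le_less_trans)
    qed
    finally show ?thesis .
  qed
  have "star_body A"
    unfolding star_body_def
  proof (intro conjI ballI impI star)
    fix \<theta> :: 'a assume th: "\<theta> \<in> sphere 0 1" "radial_function A \<theta> < \<infinity>"
    then show "enn2real (radial_function A \<theta>) *\<^sub>R \<theta> \<in> A"
      using mem[OF th(1), of "enn2real (radial_function A \<theta>)"] rf[OF th(1)] by simp
  qed
  then show ?thesis using rf unfolding has_radial_function_def by blast
qed

lemma ex1_has_radial_function: "\<exists>!A. has_radial_function A f"
proof (rule ex_ex1I[OF ex_has_radial_function])
  show "A = B" if "has_radial_function A f" "has_radial_function B f" for A B
    using that by (intro star_body_eqI) (simp_all add: has_radial_function_def)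
qed

lemma star_body_star_body_of: "star_body (star_body_of f)"
  and radial_function_star_body_of:
    "\<theta> \<in> sphere 0 1 \<Longrightarrow> radial_function (star_body_of f) \<theta> = f \<theta>"
  using theI'[OF ex1_has_radial_function[of f]]
  by (auto simp: star_body_of_def has_radial_function_def)

lemma radial_function_scaled_ball:
  fixes \<theta> :: "'a::euclidean_space"
  assumes "\<theta> \<in> sphere 0 1" "\<alpha> > 0"
  shows "radial_function ((*\<^sub>R) \<alpha> ` cball 0 1) \<theta> = ennreal \<alpha>"
proof -
  have "(*\<^sub>R) \<alpha> ` cball 0 1 = (cball 0 \<alpha> :: 'a set)"
    using cball_scale[of \<alpha> 0 1] assms by simp
  then show ?thesis
    unfolding radial_function_def using assms
    by (intro antisym SUP_least SUP_upper2[of \<alpha>]) (auto intro!: ennreal_leI)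
qed

lemma mem_radial_sum_ball:
  assumes "\<theta> \<in> sphere 0 1" "\<alpha> > 0" "0 \<le> r"
  shows "r *\<^sub>R \<theta> \<in> radial_sum A ((*\<^sub>R) \<alpha> ` cball 0 1) \<longleftrightarrow>
    ennreal r \<le> radial_function A \<theta> + ennreal \<alpha>"
  using mem_star_body_iff[OF star_body_star_body_of assms(1,3)] assms
  by (simp add: radial_sum_def radial_function_star_body_of radial_function_scaled_ball
      del: mem_sphere mem_sphere_0)

lemma radial_dist_polar:
  assumes "\<theta> \<in> sphere 0 1" "0 \<le> r"
  shows "radial_dist (r *\<^sub>R \<theta>) A =
    Inf {\<alpha>. \<alpha> > 0 \<and> ennreal r \<le> radial_function A \<theta> + ennreal \<alpha>}"
  unfolding radial_dist_def using mem_radial_sum_ball[OF assms(1) _ assms(2)]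
  by (intro arg_cong[where f = Inf]) auto

lemma radial_dist_nonneg: "0 \<le> radial_dist x A"
  and radial_dist_le_norm: "radial_dist x A \<le> norm x"
proof -
  obtain \<theta> where th: "\<theta> \<in> sphere 0 1" "x = norm x *\<^sub>R \<theta>" by (rule polar_form)
  let ?S = "{\<alpha>. \<alpha> > 0 \<and> ennreal (norm x) \<le> radial_function A \<theta> + ennreal \<alpha>}"
  have eq: "radial_dist x A = Inf ?S" using radial_dist_polar[OF th(1), of "norm x"] th(2) by simp
  have mem: "norm x + e \<in> ?S" if "e > 0" for e
  proof -
    have "ennreal (norm x) \<le> ennreal (norm x + e)" using that by (intro ennreal_leI) simp
    also have "\<dots> \<le> radial_function A \<theta> + ennreal (norm x + e)"
      by (rule add_increasing) simp_all
    finally show ?thesis using that by (simp add: add_nonneg_pos)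
  qed
  then have ne: "?S \<noteq> {}" by (metis empty_iff zero_less_one)
  show "0 \<le> radial_dist x A" unfolding eq using ne by (intro cInf_greatest) auto
  have bdd: "bdd_below ?S" by (rule bdd_belowI[of _ 0]) auto
  show "radial_dist x A \<le> norm x" unfolding eq
    by (rule field_le_epsilon) (rule cInf_lower[OF mem bdd])
qed

lemma radial_dist_eq_0_iff:
  assumes "star_body A"
  shows "radial_dist x A = 0 \<longleftrightarrow> x \<in> A"
proof -
  obtain \<theta> where th: "\<theta> \<in> sphere 0 1" "x = norm x *\<^sub>R \<theta>" by (rule polar_form)
  let ?S = "{\<alpha>. \<alpha> > 0 \<and> ennreal (norm x) \<le> radial_function A \<theta> + ennreal \<alpha>}"
  have eq: "radial_dist x A = Inf ?S" using radial_dist_polar[OF th(1), of "norm x"] th(2) by simp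
  have inA: "x \<in> A \<longleftrightarrow> ennreal (norm x) \<le> radial_function A \<theta>"
    using mem_star_body_iff[OF assms th(1), of "norm x"] th(2) by simp
  have bdd: "bdd_below ?S" by (rule bdd_belowI[of _ 0]) auto
  show ?thesis
  proof
    assume z: "radial_dist x A = 0"
    have ne: "?S \<noteq> {}"
    proof -
      have "ennreal (norm x) \<le> ennreal (norm x + 1)" by (intro ennreal_leI) simp
      also have "\<dots> \<le> radial_function A \<theta> + ennreal (norm x + 1)"
        by (rule add_increasing) simp_all
      finally have "norm x + 1 \<in> ?S" by (simp add: add_nonneg_pos)
      then show ?thesis by blast
    qed
    have "ennreal (norm x) \<le> radial_function A \<theta>"
    proof (rule ennreal_le_epsilon)
      fix e :: real assume "0 < e"
      then have "Inf ?S < e" using z eq by simp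
      then obtain a where a: "a \<in> ?S" "a < e" using cInf_less_iff[OF ne bdd] by blast
      then have "ennreal (norm x) \<le> radial_function A \<theta> + ennreal a" by simp
      also have "\<dots> \<le> radial_function A \<theta> + ennreal e"
        using a by (intro add_left_mono ennreal_leI) simp
      finally show "ennreal (norm x) \<le> radial_function A \<theta> + ennreal e" .
    qed
    then show "x \<in> A" using inA by simp
  next
    assume "x \<in> A"
    then have le: "ennreal (norm x) \<le> radial_function A \<theta>" using inA by simp
    have "Inf ?S \<le> 0"
    proof (rule field_le_epsilon)
      fix e :: real assume "0 < e"
      then have "e \<in> ?S" using add_increasing2[OF _ le, of "ennreal e"] by simp
      then show "Inf ?S \<le> 0 + e" using cInf_lower[OF _ bdd] by simp
    qed
    then show "radial_dist x A = 0" using eq radial_dist_nonneg[of x A] by simp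
  qed
qed

lemma bdd_above_radial_dist_diff:
  "bdd_above ((\<lambda>x. \<bar>radial_dist x A - radial_dist x B\<bar>) ` cball 0 R)"
proof (rule bdd_aboveI2)
  fix x :: 'a assume "x \<in> cball 0 R"
  then show "\<bar>radial_dist x A - radial_dist x B\<bar> \<le> R"
    using radial_dist_nonneg[of x A] radial_dist_nonneg[of x B]
      radial_dist_le_norm[of x A] radial_dist_le_norm[of x B] by simp
qed

lemma Metric_space_radial_AW:
  "Metric_space (star_bodies :: 'a::euclidean_space set set) radial_AW_dist"
proof
  define D where "D = (\<lambda>(A::'a set) B j. SUP x\<in>cball 0 (real j). \<bar>radial_dist x A - radial_dist x B\<bar>)"
  have AW: "radial_AW_dist A B = (SUP j\<in>{1::nat..}. min (1 / real j) (D A B j))" for A B :: "'a set"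
    by (simp add: radial_AW_dist_def D_def)
  have le_D: "\<bar>radial_dist x A - radial_dist x B\<bar> \<le> D A B j" if "norm x \<le> real j" for A B x j
    unfolding D_def using bdd_above_radial_dist_diff that by (intro cSUP_upper) auto
  have D_nonneg: "0 \<le> D A B j" for A B j
    using le_D[of 0 j A B] by simp
  have bdd: "bdd_above ((\<lambda>j. min (1 / real j) (D A B j)) ` {1..})" for A B
    by (rule bdd_aboveI2[of _ _ 1]) (auto intro: min.coboundedI1)
  have le_AW: "min (1 / real j) (D A B j) \<le> radial_AW_dist A B" if "1 \<le> j" for A B j
    unfolding AW using bdd that by (intro cSUP_upper) auto
  show nn: "0 \<le> radial_AW_dist A B" for A B :: "'a set"
    using le_AW[of 1 A B] D_nonneg[of A B 1] by simp
  show "radial_AW_dist A B = radial_AW_dist B A" for A B :: "'a set"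
    by (simp add: radial_AW_dist_def abs_minus_commute)
  show "radial_AW_dist A B = 0 \<longleftrightarrow> A = B" if "A \<in> star_bodies" "B \<in> star_bodies" for A B :: "'a set"
  proof
    assume z: "radial_AW_dist A B = 0"
    have "radial_dist x A = radial_dist x B" for x
    proof -
      obtain j :: nat where j: "norm x \<le> real j" "1 \<le> j"
        by (metis real_arch_simple max.cobounded1 max.cobounded2 of_nat_le_iff order_trans)
      have "min (1 / real j) (D A B j) \<le> 0" using le_AW[OF j(2), of A B] z by simp
      then have "D A B j \<le> 0" using j by (auto simp: min_def split: if_splits)
      then show ?thesis using le_D[OF j(1), of A B] by simp
    qed
    then show "A = B" using radial_dist_eq_0_iff that by (metis mem_Collect_eq set_eqI star_bodies_def)
  next
    assume "A = B"
    then show "radial_AW_dist A B = 0" by (simp add: radial_AW_dist_def)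
  qed
  show "radial_AW_dist A C \<le> radial_AW_dist A B + radial_AW_dist B C" for A B C :: "'a set"
    unfolding AW[of A C]
  proof (rule cSUP_least)
    fix j :: nat assume "j \<in> {1..}"
    then have j: "1 \<le> j" by simp
    have "D A C j \<le> D A B j + D B C j"
    proof -
      have "(SUP x\<in>cball 0 (real j). \<bar>radial_dist x A - radial_dist x C\<bar>) \<le> D A B j + D B C j"
      proof (rule cSUP_least)
        fix x :: 'a assume "x \<in> cball 0 (real j)"
        then have "norm x \<le> real j" by simp
        from le_D[OF this, of A B] le_D[OF this, of B C]
        show "\<bar>radial_dist x A - radial_dist x C\<bar> \<le> D A B j + D B C j" by linarith
      qed simp
      then show ?thesis by (simp add: D_def)
    qed
    then have "min (1 / real j) (D A C j) \<le> min (1 / real j) (D A B j) + min (1 / real j) (D B C j)"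
      using D_nonneg[of A B j] D_nonneg[of B C j] divide_nonneg_nonneg[of 1 "real j"]
      unfolding min_def by (smt (verit) of_nat_0_le_iff)
    then show "min (1 / real j) (D A C j) \<le> radial_AW_dist A B + radial_AW_dist B C"
      using le_AW[OF j, of A B] le_AW[OF j, of B C] by linarith
  qed simp
qed

end

theory Submission
  imports Defs
begin

text \<open>Since \<open>d\<^sub>r(r\<theta>, A) = r - min(r, \<rho>\<^sub>A(\<theta>))\<close>, the radial Attouch-Wets distance measures the uniform
  distance between radial functions truncated at a large level. Inverting and truncating at \<open>J\<close>
  gives \<open>1 / max(1/J, \<rho>\<^sub>A)\<close>, which changes by at most \<open>1/k\<close> when \<open>\<rho>\<^sub>A\<close> is itself truncated at
  \<open>k\<close>, and \<open>t \<mapsto> 1 / max(1/J, t)\<close> is Lipschitz with constant \<open>J\<^sup>2\<close>. Hence the duality is even uniformly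
  continuous.\<close>

text \<open>The minimum is formed before \<open>enn2real\<close>, so the value \<open>top\<close> is
  sent to \<open>r\<close> and not to the default 0.\<close>

definition trunc :: "real \<Rightarrow> ennreal \<Rightarrow> real" where
  "trunc r x = enn2real (min (ennreal r) x)"

lemma trunc_top: "0 \<le> r \<Longrightarrow> trunc r top = r"
  by (simp add: trunc_def)

lemma trunc_ennreal: "0 \<le> r \<Longrightarrow> 0 \<le> s \<Longrightarrow> trunc r (ennreal s) = min r s"
  by (simp add: trunc_def min_def)

lemma radial_dist_eq_diff_trunc:
  assumes "\<theta> \<in> sphere 0 1" "0 \<le> r"
  shows "radial_dist (r *\<^sub>R \<theta>) A = r - trunc r (radial_function A \<theta>)"
proof (cases "radial_function A \<theta>")
  case (real s)
  have "{\<alpha>. \<alpha> > 0 \<and> ennreal r \<le> radial_function A \<theta> + ennreal \<alpha>} = {\<alpha>. \<alpha> > 0 \<and> r - s \<le> \<alpha>}"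
    using real by (auto simp flip: ennreal_plus)
  also have "Inf \<dots> = r - min r s"
  proof (cases "r \<le> s")
    \<comment> \<open>Here \<open>\<alpha> > 0\<close> is the binding constraint: the infimum 0 is
      not attained, but equals \<open>r - min r s\<close>.\<close>
    case True
    then have "{\<alpha>. \<alpha> > 0 \<and> r - s \<le> \<alpha>} = {0<..}" by auto
    then show ?thesis using True by simp
  next
    case False
    then have "{\<alpha>. \<alpha> > 0 \<and> r - s \<le> \<alpha>} = {r - s..}" by auto
    then show ?thesis using False by simp
  qed
  finally show ?thesis using radial_dist_polar[OF assms, of A] real assms by (simp add: trunc_ennreal)
next
  case top
  then have "{\<alpha>. \<alpha> > 0 \<and> ennreal r \<le> radial_function A \<theta> + ennreal \<alpha>} = {0<..}" by auto
  then show ?thesis using radial_dist_polar[OF assms, of A] top assms by (simp add: trunc_top)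
qed

text \<open>For \<open>r \<le> R\<close>, truncating at \<open>r\<close> is truncating at
  \<open>R\<close> followed by \<open>min r\<close>, which is 1-Lipschitz. Thus one large level
  controls all smaller radii.\<close>

lemma abs_trunc_diff_mono:
  assumes "0 \<le> r" "r \<le> R"
  shows "\<bar>trunc r x - trunc r y\<bar> \<le> \<bar>trunc R x - trunc R y\<bar>"
  using assms by (cases x; cases y) (auto simp: trunc_ennreal trunc_top min_def)

text \<open>A distance below \<open>1 / real k\<close> excludes the cap in the term of index
  \<open>k\<close>, so the supremum over the ball of radius \<open>k\<close> is bounded; evaluate it
  at \<open>real k *\<^sub>R \<theta>\<close>.\<close>

lemma abs_trunc_diff_le_radial_AW_dist:
  assumes "\<theta> \<in> sphere 0 1" "1 \<le> k" "radial_AW_dist A B < 1 / real k"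
  shows "\<bar>trunc (real k) (radial_function A \<theta>) - trunc (real k) (radial_function B \<theta>)\<bar>
    \<le> radial_AW_dist A B"
proof -
  let ?D = "\<lambda>j. SUP x\<in>cball 0 (real j). \<bar>radial_dist x A - radial_dist x B\<bar>"
  have "min (1 / real k) (?D k) \<le> radial_AW_dist A B"
    unfolding radial_AW_dist_def
    by (intro cSUP_upper bdd_aboveI2[of _ _ 1]) (use assms in \<open>auto intro: min.coboundedI1\<close>)
  then have "?D k \<le> radial_AW_dist A B" using assms(3) by linarith
  moreover have "\<bar>radial_dist (real k *\<^sub>R \<theta>) A - radial_dist (real k *\<^sub>R \<theta>) B\<bar> \<le> ?D k"
    using assms(1) by (intro cSUP_upper bdd_above_radial_dist_diff) auto
  ultimately show ?thesis by (simp add: radial_dist_eq_diff_trunc[OF assms(1)])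
qed

text \<open>Converse estimate: indices up to \<open>J\<close> reduce to level \<open>J\<close> by
  monotonicity in the level, and for larger ones the cap \<open>1 / real j\<close> is already at
  most \<open>e\<close>.\<close>

lemma radial_AW_dist_le:
  assumes J: "1 \<le> J" "1 / real J \<le> e"
    and le: "\<And>\<theta>. \<theta> \<in> sphere 0 1 \<Longrightarrow>
      \<bar>trunc (real J) (radial_function A \<theta>) - trunc (real J) (radial_function B \<theta>)\<bar> \<le> e"
  shows "radial_AW_dist A B \<le> e"
  unfolding radial_AW_dist_def
proof (rule cSUP_least)
  fix j :: nat assume j: "j \<in> {1..}"
  let ?D = "SUP x\<in>cball 0 (real j). \<bar>radial_dist x A - radial_dist x B\<bar>"
  show "min (1 / real j) ?D \<le> e"
  proof (cases "j \<le> J")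
    case True
    have "?D \<le> e"
    proof (rule cSUP_least)
      fix x :: 'a assume x: "x \<in> cball 0 (real j)"
      obtain \<theta> where th: "\<theta> \<in> sphere 0 1" "x = norm x *\<^sub>R \<theta>" by (rule polar_form)
      have eq: "radial_dist x C = norm x - trunc (norm x) (radial_function C \<theta>)" for C
        using radial_dist_eq_diff_trunc[OF th(1), of "norm x" C] th(2) by simp
      have "norm x \<le> real J" using x True by simp
      from abs_trunc_diff_mono[OF norm_ge_zero this, of "radial_function A \<theta>" "radial_function B \<theta>"]
        le[OF th(1)]
      show "\<bar>radial_dist x A - radial_dist x B\<bar> \<le> e" unfolding eq by linarith
    qed simp
    then show ?thesis by simp
  next
    case False
    then have "1 / real j \<le> 1 / real J" using J by (intro divide_left_mono) auto
    then show ?thesis using J(2) by linarith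
  qed
qed simp

lemma trunc_inverse:
  assumes "0 < J" "1 / J \<le> k"
  shows "\<bar>trunc J (inverse x) - 1 / max (1 / J) (trunc k x)\<bar> \<le> 1 / k"
proof -
  have k: "0 < k" using assms by (meson less_le_trans zero_less_divide_1_iff)
  show ?thesis
  proof (cases x)
    case (real s)
    show ?thesis
    proof (cases "s = 0")
      case True
      then show ?thesis using real assms k by (simp add: trunc_top trunc_ennreal[of k 0, simplified])
    next
      case False
      then have s: "0 < s" using real by simp
      have *: "trunc J (inverse x) = min J (1 / s)"
        using real s assms by (simp add: inverse_ennreal trunc_ennreal inverse_eq_divide)
      have **: "min J (1 / s) = 1 / max (1 / J) s"
        using s assms by (auto simp: min_def max_def field_simps)
      show ?thesis
      proof (cases "s \<le> k")
        case True
        then show ?thesis using * ** real k by (simp add: trunc_ennreal)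
      next
        \<comment> \<open>Beyond level \<open>k\<close> both quantities lie between 0 and
          \<open>1 / k\<close>; \<open>1 / J \<le> k\<close> makes the second one exactly
          \<open>1 / k\<close>. Up to level \<open>k\<close> they agree.\<close>
        case False
        then have "1 / s \<le> 1 / k" using k by (simp add: frac_le)
        then have "0 \<le> min J (1 / s)" "min J (1 / s) \<le> 1 / k" using s assms by auto
        moreover have "max (1 / J) (trunc k x) = k"
          using real False k assms(2) by (simp add: trunc_ennreal)
        ultimately show ?thesis using * by (simp add: abs_le_iff)
      qed
    qed
  next
    case top
    then show ?thesis using assms k by (simp add: trunc_top trunc_ennreal[of J 0, simplified])
  qed
qed

text \<open>The map \<open>max a\<close> is 1-Lipschitz, and both denominators are at least
  \<open>a\<close>.\<close>

lemma abs_inverse_max_diff_le: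
  fixes a :: real
  assumes "0 < a"
  shows "\<bar>1 / max a s - 1 / max a t\<bar> \<le> \<bar>s - t\<bar> / a\<^sup>2"
proof -
  let ?u = "max a s" and ?v = "max a t"
  have uv: "a \<le> ?u" "a \<le> ?v" by auto
  then have "1 / ?u - 1 / ?v = (?v - ?u) / (?u * ?v)" using assms by (simp add: field_simps)
  then have "\<bar>1 / ?u - 1 / ?v\<bar> = \<bar>?v - ?u\<bar> / (?u * ?v)" using assms uv by (simp add: abs_mult)
  also have "\<dots> \<le> \<bar>s - t\<bar> / a\<^sup>2"
    unfolding power2_eq_square using assms uv
    by (intro frac_le mult_mono) (auto simp: max_def)
  finally show ?thesis .
qed

lemma radial_function_star_duality:
  "\<theta> \<in> sphere 0 1 \<Longrightarrow> radial_function (star_duality A) \<theta> = inverse (radial_function A \<theta>)"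
  by (simp only: star_duality_def radial_function_star_body_of)

lemma star_duality_uniformly_continuous:
  fixes e :: real
  assumes "0 < e"
  obtains d where "0 < d"
    "\<And>A B :: 'a::euclidean_space set. radial_AW_dist A B < d \<Longrightarrow>
      radial_AW_dist (star_duality A) (star_duality B) < e"
proof -
  obtain J :: nat where J: "1 \<le> J" "1 / real J \<le> e / 2"
  proof -
    obtain n :: nat where "inverse (real (Suc n)) < e / 2" using reals_Archimedean[of "e / 2"] assms by auto
    then show thesis using that[of "Suc n"] by (simp add: inverse_eq_divide)
  qed
  obtain k :: nat where k: "1 \<le> k" "1 / real k < e / 8"
  proof -
    obtain n :: nat where "inverse (real (Suc n)) < e / 8" using reals_Archimedean[of "e / 8"] assms by auto
    then show thesis using that[of "Suc n"] by (simp add: inverse_eq_divide)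
  qed
  \<comment> \<open>The first entry permits comparison at level \<open>k\<close>. The second,
    multiplied by the Lipschitz constant \<open>(real J)\<^sup>2\<close>, gives
    \<open>e / 4\<close>; the two truncation errors, each below \<open>e / 8\<close>, bring the
    total to at most \<open>e / 2\<close>.\<close>
  define d where "d = min (1 / real k) (e / (4 * (real J)\<^sup>2))"
  show thesis
  proof (rule that[of d])
    show "0 < d" using assms J k by (simp add: d_def)
  next
    fix A B :: "'a set" assume AB: "radial_AW_dist A B < d"
    \<comment> \<open>A supremum inherits only a weak bound from its terms; aiming at
      \<open>e / 2\<close> restores strictness.\<close>
    have "radial_AW_dist (star_duality A) (star_duality B) \<le> e / 2"
    proof (rule radial_AW_dist_le[OF J])
      fix \<theta> :: 'a assume th: "\<theta> \<in> sphere 0 1"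
      let ?x = "radial_function A \<theta>" and ?y = "radial_function B \<theta>"
      let ?s = "trunc (real k) ?x" and ?t = "trunc (real k) ?y"
      have "\<bar>?s - ?t\<bar> \<le> e / (4 * (real J)\<^sup>2)"
        using abs_trunc_diff_le_radial_AW_dist[OF th k(1), of A B] AB by (simp add: d_def)
      then have "\<bar>?s - ?t\<bar> / (1 / real J)\<^sup>2 \<le> e / 4"
        using J(1) by (simp add: field_simps)
      moreover have "\<bar>1 / max (1 / real J) ?s - 1 / max (1 / real J) ?t\<bar> \<le> \<bar>?s - ?t\<bar> / (1 / real J)\<^sup>2"
        using J(1) by (intro abs_inverse_max_diff_le) simp
      moreover have "1 / real J \<le> real k" "0 < real J"
        using J(1) k(1) by (auto simp: divide_le_eq intro: order_trans[of _ "real k"])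
      note trunc_inverse[OF this(2,1), of ?x] trunc_inverse[OF this(2,1), of ?y]
      ultimately show "\<bar>trunc (real J) (radial_function (star_duality A) \<theta>)
          - trunc (real J) (radial_function (star_duality B) \<theta>)\<bar> \<le> e / 2"
        unfolding radial_function_star_duality[OF th] using k(2) by linarith
    qed
    then show "radial_AW_dist (star_duality A) (star_duality B) < e" using assms by simp
  qed
qed

theorem theorem5p6:
  assumes "CARD('n::finite) \<ge> 2"
  shows "continuous_map
           (Metric_space.mtopology (star_bodies :: (real ^ 'n) set set) radial_AW_dist)
           (Metric_space.mtopology (star_bodies :: (real ^ 'n) set set) radial_AW_dist)
           star_duality"
proof -
  let ?S = "star_bodies :: (real ^ 'n) set set"
  interpret Metric_space ?S radial_AW_dist by (rule Metric_space_radial_AW)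
  \<comment> \<open>\<open>metric_continuous_map\<close> asks for this inclusion besides the
    epsilon-delta condition.\<close>
  have "star_duality ` ?S \<subseteq> ?S"
    by (auto simp: star_bodies_def star_duality_def star_body_star_body_of)
  moreover have "\<exists>d>0. \<forall>B. B \<in> ?S \<and> radial_AW_dist A B < d \<longrightarrow>
      radial_AW_dist (star_duality A) (star_duality B) < e" if "0 < e" for A :: "(real ^ 'n) set" and e
    using star_duality_uniformly_continuous[OF that, where 'a = "real ^ 'n"] by metis
  ultimately show ?thesis
    unfolding metric_continuous_map[OF Metric_space_radial_AW] by blast
qed

end
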